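(* Let $l\ge1$, let $\mathbf{u}^{(i)}:\mathcal{P}\to U$, $i=1,\dots,l$, be parameter-dependent vectors, and let $$\mathcal{M}=\Big\{\sum_{i=1}^l\mathbf{u}^{(i)}(\mu):\mu\in\mathcal{P}\Big\},\qquad \mathcal{M}^{(i)}=\{\mathbf{u}^{(i)}(\mu):\mu\in\mathcal{P}\},\quad 1\le i\le l.$$ Then, for all positive integers $r_i\le K_i$ ($1\le i\le l$), with $r=\sum_{i=1}^l r_i$ and $K=\sum_{i=1}^l K_i$, $$\sigma_r(\mathcal{M};K)\le\sum_{i=1}^l\sigma_{r_i}(\mathcal{M}^{(i)};K_i).$$
   Context: $U=\mathbb{K}^n$ ($n\ge1$, $\mathbb{K}=\mathbb{R}$ or $\mathbb{C}$) is equipped with an inner product $\langle\cdot,\cdot\rangle_U$ (given by a symmetric/Hermitian positive definite matrix) and norm $\|\cdot\|_U$; $\mathbf{P}_W$ denotes the orthogonal projection of $U$ onto a subspace $W$ with respect to $\langle\cdot,\cdot\rangle_U$. $\mathcal{P}$ is a (nonempty) parameter set. For a finite set (dictionary) $\mathcal{D}_K\subset U$ of $K\ge r$ vectors, $\mathcal{L}_r(\mathcal{D}_K)$ is the collection of all subspaces of $U$ spanned by $r$ vectors from $\mathcal{D}_K$. For a set $\mathcal{M}\subset U$, the dictionary-based $r$-width is $$\sigma_r(\mathcal{M};K)=\inf_{\#\mathcal{D}_K=K}\ \sup_{\mathbf{u}\in\mathcal{M}}\ \min_{W_r\in\mathcal{L}_r(\mathcal{D}_K)}\|\mathbf{u}-\mathbf{P}_{W_r}\mathbf{u}\|_U\in[0,\infty],$$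 the infimum being over all subsets $\mathcal{D}_K$ of $U$ with cardinality $K$. *)

theory Defs
  imports "HOL-Analysis.Analysis"
begin

(* The scalar field is real or complex; c is its conjugation, i.e. id for the reals
   and cnj for the complex numbers. *)
definition mat_inner ::
  "('k::real_normed_field \<Rightarrow> 'k) \<Rightarrow> 'k ^ 'n ^ 'n \<Rightarrow> 'k ^ 'n \<Rightarrow> 'k ^ 'n \<Rightarrow> 'k" where
  "mat_inner c R x y = (\<Sum>i\<in>UNIV. (R *v x) $ i * c (y $ i))"

(* "= of_real t" with t > 0 says that the quadratic form is real and positive, for either field. *)
definition hermitian_posdef ::
  "('k::real_normed_field \<Rightarrow> 'k) \<Rightarrow> 'k ^ 'n ^ 'n \<Rightarrow> bool" where
  "hermitian_posdef c R \<longleftrightarrow>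
     (\<forall>i j. R $ i $ j = c (R $ j $ i)) \<and>
     (\<forall>x. x \<noteq> 0 \<longrightarrow> (\<exists>t>0. mat_inner c R x x = of_real t))"

(* ip x x is a nonnegative real scalar, so norm only converts it from type 'k to real. *)
definition ip_norm ::
  "('k::real_normed_field ^ 'n \<Rightarrow> 'k ^ 'n \<Rightarrow> 'k) \<Rightarrow> 'k ^ 'n \<Rightarrow> real" where
  "ip_norm ip x = sqrt (norm (ip x x))"

definition orth_proj ::
  "('k::real_normed_field ^ 'n \<Rightarrow> 'k ^ 'n \<Rightarrow> 'k) \<Rightarrow> ('k ^ 'n) set \<Rightarrow> 'k ^ 'n \<Rightarrow> 'k ^ 'n" where
  "orth_proj ip W u = (THE p. p \<in> W \<and> (\<forall>w\<in>W. ip (u - p) w = 0))"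

(* vec.span is the span over the scalar field 'k, not the real span. *)
definition dict_spaces :: "nat \<Rightarrow> ('k::field ^ 'n) set \<Rightarrow> ('k ^ 'n) set set" where
  "dict_spaces r D = {vec.span S | S. S \<subseteq> D \<and> card S = r}"

(* Min ranges over a finite nonempty set only if r \<le> K. *)
definition dict_width ::
  "('k::real_normed_field ^ 'n \<Rightarrow> 'k ^ 'n \<Rightarrow> 'k) \<Rightarrow> nat \<Rightarrow> ('k ^ 'n) set \<Rightarrow> nat \<Rightarrow> ennreal" where
  "dict_width ip r M K =
     (INF D \<in> {D. finite D \<and> card D = K}. SUP u \<in> M.
        Min ((\<lambda>W. ennreal (ip_norm ip (u - orth_proj ip W u))) ` dict_spaces r D))"

end

(* Take dictionaries D_i that are nearly optimal for the sets M_i and any dictionary D with K elements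
   containing their union; it need not be a disjoint union. If S_i is the r_i-element subset of D_i
   that is best for u_i(mu), then the union of the S_i extends to an r-element subset S of D. As the
   orthogonal projection onto span S is a best approximation, the error of the sum is at most the norm
   of the sum of the individual errors, and the triangle inequality concludes. *)
theory Submission
  imports Defs
begin

section \<open>Cardinalities and infima of extended reals\<close>

text \<open>Serves to enlarge the union of possibly overlapping dictionaries to exactly the
  prescribed size; the missing elements come from the infinite complement.\<close>

lemma finite_superset_card:
  assumes "infinite (UNIV :: 'a set)" "finite A" "card A \<le> n"
  obtains D :: "'a set" where "A \<subseteq> D" "finite D" "card D = n"
proof -
  have "infinite (- A)" using assms by (simp add: Compl_eq_Diff_UNIV)
  then obtain B where "finite B" "card B = n - card A" "B \<subseteq> - A"
    using infinite_arbitrarily_large by metis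
  moreover from this have "card (A \<union> B) = n"
    using assms by (subst card_Un_disjoint) auto
  ultimately show thesis using that[of "A \<union> B"] assms(2) by blast
qed

lemma infinite_UNIV_vec: "infinite (UNIV :: ('k::field_char_0 ^ 'n) set)"
proof
  assume "finite (UNIV :: ('k ^ 'n) set)"
  then have "finite (range (vec :: 'k \<Rightarrow> 'k ^ 'n))" by (rule finite_subset[OF subset_UNIV])
  moreover have "inj (vec :: 'k \<Rightarrow> 'k ^ 'n)" by (auto simp: inj_def vec_eq_iff)
  ultimately show False using finite_imageD infinite_UNIV_char_0 by blast
qed

text \<open>Reduces a bound by a sum of infima to one for a fixed choice of members. The infima need
  not be attained, so near-minimisers are chosen and an arbitrary error \<open>e\<close> is split
  evenly among the indices.\<close>

lemma le_sum_INF_ennreal: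
  fixes f :: "'i \<Rightarrow> 'a \<Rightarrow> ennreal"
  assumes "finite I"
    and le: "\<And>E. (\<And>i. i \<in> I \<Longrightarrow> E i \<in> A i) \<Longrightarrow> y \<le> (\<Sum>i\<in>I. f i (E i))"
  shows "y \<le> (\<Sum>i\<in>I. INF D \<in> A i. f i D)"
proof (rule ennreal_le_epsilon)
  fix e :: real
  assume fin: "(\<Sum>i\<in>I. INF D \<in> A i. f i D) < top" and e: "0 < e"
  \<comment> \<open>The \<open>+ 1\<close> keeps the denominator positive when \<open>I\<close> is
    empty.\<close>
  define d where "d = e / (card I + 1)"
  have d: "d > 0" "card I * d \<le> e" using e by (auto simp: d_def field_simps)
  have "\<exists>D \<in> A i. f i D < (INF D \<in> A i. f i D) + ennreal d" if "i \<in> I" for i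
  proof -
    \<comment> \<open>A finite sum has finite summands. Finiteness makes adding \<open>d\<close> a
      strict increase, and it rules out an empty \<open>A i\<close>, whose infimum would be
      \<open>top\<close>.\<close>
    have "(INF D \<in> A i. f i D) < top" using fin that \<open>finite I\<close> by (simp add: less_top)
    moreover have "m < m + ennreal d" if "m < top" for m
      using that d(1) ennreal_add_left_cancel_less[of m 0 "ennreal d"] by (simp add: less_top)
    ultimately have "(INF D \<in> A i. f i D) < (INF D \<in> A i. f i D) + ennreal d" by blast
    then show ?thesis by (simp only: INF_less_iff)
  qed
  then obtain E where E: "\<And>i. i \<in> I \<Longrightarrow> E i \<in> A i"
    "\<And>i. i \<in> I \<Longrightarrow> f i (E i) < (INF D \<in> A i. f i D) + ennreal d"
    by metis
  have "y \<le> (\<Sum>i\<in>I. f i (E i))" using E(1) by (rule le)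
  also have "\<dots> \<le> (\<Sum>i\<in>I. (INF D \<in> A i. f i D) + ennreal d)"
    using E(2) by (intro sum_mono) (simp add: less_imp_le)
  also have "\<dots> = (\<Sum>i\<in>I. INF D \<in> A i. f i D) + ennreal (card I * d)"
    using d by (simp add: sum.distrib ennreal_mult ennreal_of_nat_eq_real_of_nat)
  also have "\<dots> \<le> (\<Sum>i\<in>I. INF D \<in> A i. f i D) + ennreal e"
    using d by (intro add_left_mono ennreal_leI)
  finally show "y \<le> (\<Sum>i\<in>I. INF D \<in> A i. f i D) + ennreal e" .
qed

lemma finite_dict_spaces: "finite D \<Longrightarrow> finite (dict_spaces r D)"
  by (simp add: dict_spaces_def)

section \<open>Inner products over both scalar fields\<close>

text \<open>Collects what \<open>id\<close> on the reals and \<open>cnj\<close> on the complex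
  numbers have in common, so that one argument covers both fields. As \<open>'k\<close> carries no
  order, positivity is stated through \<open>of_real\<close>.\<close>

locale conj_inner =
  fixes c :: "'k::real_normed_field \<Rightarrow> 'k" and ip :: "'k ^ 'n \<Rightarrow> 'k ^ 'n \<Rightarrow> 'k"
  assumes conj_add: "c (a + b) = c a + c b"
    and conj_mult: "c (a * b) = c a * c b"
    and norm_conj: "norm (c a) = norm a"
    and ip_add_left: "ip (x + y) z = ip x z + ip y z"
    and ip_scale_left: "ip (a *s x) z = a * ip x z"
    and ip_swap: "ip y x = c (ip x y)"
    and ip_pos: "x \<noteq> 0 \<Longrightarrow> \<exists>t>0. ip x x = of_real t"
begin

lemma conj_zero [simp]: "c 0 = 0"
  using norm_conj[of 0] by simp

lemma ip_add_right: "ip x (y + z) = ip x y + ip x z"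
  by (metis ip_swap ip_add_left conj_add)

lemma ip_scale_right: "ip x (a *s y) = c a * ip x y"
  by (metis ip_swap ip_scale_left conj_mult)

lemma ip_zero_left [simp]: "ip 0 x = 0"
  using ip_scale_left[of 0 x x] by simp

lemma ip_zero_right [simp]: "ip x 0 = 0"
  by (metis ip_swap ip_zero_left conj_zero)

lemma ip_diff_left: "ip (x - y) z = ip x z - ip y z"
  using ip_add_left[of "x - y" y z] by simp

text \<open>Positivity makes \<open>ip x x\<close> a nonnegative real scalar, so the
  \<open>norm\<close> inside \<open>ip_norm\<close> loses no information and identities in
  \<open>'k\<close> can be read as identities of real norms.\<close>

lemma ip_self: "ip x x = of_real ((ip_norm ip x)\<^sup>2)"
proof (cases "x = 0")
  case False
  then obtain t where "t > 0" "ip x x = of_real t" using ip_pos by blast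
  then show ?thesis by (simp add: ip_norm_def)
qed (simp add: ip_norm_def)

lemma ip_norm_nonneg [simp]: "ip_norm ip x \<ge> 0"
  by (simp add: ip_norm_def)

lemma ip_norm_zero [simp]: "ip_norm ip 0 = 0"
  by (simp add: ip_norm_def)

lemma norm_ip_self: "norm (ip x x) = (ip_norm ip x)\<^sup>2"
  by (simp add: ip_norm_def)

lemma ip_self_eq_0: "ip x x = 0 \<longleftrightarrow> x = 0"
proof
  assume "ip x x = 0"
  with ip_pos[of x] show "x = 0" by force
qed simp

lemma ip_norm_scale: "ip_norm ip (a *s x) = norm a * ip_norm ip x"
proof -
  have "norm (ip (a *s x) (a *s x)) = (norm a)\<^sup>2 * norm (ip x x)"
    by (simp only: ip_scale_left ip_scale_right norm_mult norm_conj power2_eq_square mult.assoc)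
  then show ?thesis by (simp add: ip_norm_def real_sqrt_mult)
qed

lemma ip_norm_pythagoras:
  assumes "ip x y = 0"
  shows "(ip_norm ip (x + y))\<^sup>2 = (ip_norm ip x)\<^sup>2 + (ip_norm ip y)\<^sup>2"
proof -
  have "ip y x = 0" by (metis assms ip_swap conj_zero)
  then have "ip (x + y) (x + y) = ip x x + ip y y"
    using assms by (simp add: ip_add_left ip_add_right)
  then have "(of_real ((ip_norm ip (x + y))\<^sup>2) :: 'k) = of_real ((ip_norm ip x)\<^sup>2 + (ip_norm ip y)\<^sup>2)"
    by (simp only: ip_self of_real_add)
  then show ?thesis by (simp only: of_real_eq_iff)
qed

text \<open>Splits \<open>x\<close> into its component \<open>a *s y\<close> along \<open>y\<close>
  and an orthogonal remainder; by Pythagoras the component is no longer than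
  \<open>x\<close>.\<close>

lemma ip_cauchy_schwarz: "norm (ip x y) \<le> ip_norm ip x * ip_norm ip y"
proof (cases "y = 0")
  case False
  define a where "a = ip x y / ip y y"
  have nz: "ip y y \<noteq> 0" using False ip_self_eq_0 by blast
  have orth: "ip (x - a *s y) y = 0"
    using nz by (simp add: ip_diff_left ip_scale_left a_def)
  have "ip (x - a *s y) (a *s y) = 0" by (simp add: ip_scale_right orth)
  from ip_norm_pythagoras[OF this]
  have "(ip_norm ip (a *s y))\<^sup>2 \<le> (ip_norm ip x)\<^sup>2" by simp
  then have "ip_norm ip (a *s y) \<le> ip_norm ip x"
    by (rule power2_le_imp_le) simp
  then have "norm a * ip_norm ip y \<le> ip_norm ip x"
    by (simp only: ip_norm_scale)
  then have "norm a * ip_norm ip y * ip_norm ip y \<le> ip_norm ip x * ip_norm ip y"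
    by (intro mult_right_mono) auto
  moreover have "norm (ip x y) = norm a * norm (ip y y)"
    using nz by (simp add: a_def norm_divide)
  ultimately show ?thesis by (simp add: norm_ip_self power2_eq_square mult.assoc)
qed simp

lemma ip_norm_triangle: "ip_norm ip (x + y) \<le> ip_norm ip x + ip_norm ip y"
proof (rule power2_le_imp_le)
  have "(ip_norm ip (x + y))\<^sup>2 = norm ((ip x x + ip y x) + (ip x y + ip y y))"
    by (simp add: norm_ip_self[symmetric] ip_add_left ip_add_right)
  also have "\<dots> \<le> (norm (ip x x) + norm (ip y x)) + (norm (ip x y) + norm (ip y y))"
    by (intro norm_triangle_mono norm_triangle_ineq)
  also have "\<dots> \<le> (ip_norm ip x + ip_norm ip y)\<^sup>2"
    using ip_cauchy_schwarz[of x y] ip_cauchy_schwarz[of y x]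
    by (simp add: norm_ip_self power2_sum mult_ac)
  finally show "(ip_norm ip (x + y))\<^sup>2 \<le> (ip_norm ip x + ip_norm ip y)\<^sup>2" .
qed simp

lemma ip_norm_sum_le: "ip_norm ip (\<Sum>i\<in>I. f i) \<le> (\<Sum>i\<in>I. ip_norm ip (f i))"
proof (induction I rule: infinite_finite_induct)
  case (insert i I)
  then show ?case using ip_norm_triangle[of "f i" "sum f I"] by simp
qed simp_all

section \<open>Orthogonal projection and best approximation\<close>

text \<open>Gram-Schmidt as an induction over the spanning set, which may be linearly dependent. The
  vector \<open>u\<close> stays arbitrary because the hypothesis is applied to the new generator
  \<open>a\<close> as well.\<close>

lemma orth_proj_exists:
  assumes "finite S"
  shows "\<exists>p \<in> vec.span S. \<forall>w \<in> vec.span S. ip (u - p) w = 0"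
  using assms
proof (induction S arbitrary: u rule: finite_induct)
  case empty
  then show ?case by simp
next
  case (insert a S)
  from insert.IH[of a] obtain q where q: "q \<in> vec.span S" "\<forall>w \<in> vec.span S. ip (a - q) w = 0"
    by blast
  from insert.IH[of u] obtain p where p: "p \<in> vec.span S" "\<forall>w \<in> vec.span S. ip (u - p) w = 0"
    by blast
  define b where "b = a - q"
  \<comment> \<open>one Gram-Schmidt step; for \<open>b = 0\<close> the coefficient is the junk value 0, as it should be\<close>
  define k where "k = ip (u - p) b / ip b b"
  have sub: "vec.span S \<subseteq> vec.span (insert a S)"
    by (intro vec.span_mono) auto
  have "b \<in> vec.span (insert a S)"
    unfolding b_def using q(1) sub vec.span_base[of a "insert a S"] by (intro vec.span_diff) auto
  then have mem: "p + k *s b \<in> vec.span (insert a S)"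
    using p(1) sub by (intro vec.span_add vec.span_scale) auto
  \<comment> \<open>Since \<open>b\<close> is itself orthogonal to \<open>vec.span S\<close>, the
    correction along \<open>b\<close> preserves the orthogonality already achieved by
    \<open>p\<close>.\<close>
  have orthS: "ip (u - (p + k *s b)) w = 0" if "w \<in> vec.span S" for w
    using p(2) q(2) that
    by (simp add: b_def ip_diff_left ip_add_left ip_scale_left)
  have orthb: "ip (u - (p + k *s b)) b = 0"
  proof (cases "b = 0")
    case False
    then show ?thesis
      using ip_self_eq_0[of b] by (simp add: k_def ip_diff_left ip_add_left ip_scale_left)
  qed simp
  have "ip (u - (p + k *s b)) w = 0" if "w \<in> vec.span (insert a S)" for w
  proof -
    from that obtain m where m: "w - m *s a \<in> vec.span S"
      by (auto simp: vec.span_insert)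
    then have "w - m *s a + m *s q \<in> vec.span S"
      using q(1) by (intro vec.span_add vec.span_scale)
    \<comment> \<open>Replacing \<open>a\<close> by \<open>q + b\<close> splits \<open>w\<close>
      into an element of \<open>vec.span S\<close> and a multiple of \<open>b\<close>, and
      \<open>orthS\<close> and \<open>orthb\<close> treat one summand each.\<close>
    moreover have "w = (w - m *s a + m *s q) + m *s b"
      by (simp add: b_def vec.scale_right_diff_distrib)
    ultimately show ?thesis
      by (metis ip_add_right ip_scale_right orthS orthb mult_zero_right add_0_right)
  qed
  with mem show ?case by blast
qed

text \<open>Justifies the definite description in \<open>orth_proj\<close>: the difference of two
  candidates lies in the span and is orthogonal to itself, hence zero.\<close>

lemma orth_proj_span:
  assumes "finite S"
  shows "orth_proj ip (vec.span S) u \<in> vec.span S"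
    and "w \<in> vec.span S \<Longrightarrow> ip (u - orth_proj ip (vec.span S) u) w = 0"
proof -
  have "\<exists>!p. p \<in> vec.span S \<and> (\<forall>w \<in> vec.span S. ip (u - p) w = 0)"
  proof (rule ex_ex1I)
    show "\<exists>p. p \<in> vec.span S \<and> (\<forall>w \<in> vec.span S. ip (u - p) w = 0)"
      using orth_proj_exists[OF assms, of u] by blast
  next
    fix p q
    assume p: "p \<in> vec.span S \<and> (\<forall>w \<in> vec.span S. ip (u - p) w = 0)"
      and q: "q \<in> vec.span S \<and> (\<forall>w \<in> vec.span S. ip (u - q) w = 0)"
    then have "p - q \<in> vec.span S" by (intro vec.span_diff) auto
    then have "ip (u - q) (p - q) - ip (u - p) (p - q) = 0" using p q by simp
    then have "ip (p - q) (p - q) = 0" by (simp add: ip_diff_left)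
    then show "p = q" by (simp add: ip_self_eq_0)
  qed
  from theI'[OF this] show "orth_proj ip (vec.span S) u \<in> vec.span S"
    and "w \<in> vec.span S \<Longrightarrow> ip (u - orth_proj ip (vec.span S) u) w = 0"
    unfolding orth_proj_def by auto
qed

text \<open>With \<open>?p\<close> the projection, \<open>u - w\<close> is the sum of the orthogonal
  vectors \<open>u - ?p\<close> and \<open>?p - w\<close>, so Pythagoras applies.\<close>

lemma orth_proj_best:
  assumes "finite S" "w \<in> vec.span S"
  shows "ip_norm ip (u - orth_proj ip (vec.span S) u) \<le> ip_norm ip (u - w)"
proof (rule power2_le_imp_le)
  let ?p = "orth_proj ip (vec.span S) u"
  have "?p - w \<in> vec.span S"
    using assms orth_proj_span(1) by (intro vec.span_diff) auto
  then have "ip (u - ?p) (?p - w) = 0" using assms(1) orth_proj_span(2) by blast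
  from ip_norm_pythagoras[OF this]
  show "(ip_norm ip (u - ?p))\<^sup>2 \<le> (ip_norm ip (u - w))\<^sup>2" by simp
qed simp

section \<open>Subadditivity of the dictionary error and of the width\<close>

text \<open>The core estimate, for fixed dictionaries and a single parameter value. The bounds on
  \<open>r i\<close> make each minimum on the right range over a nonempty set; \<open>rD\<close>
  leaves room in \<open>D\<close> for a subset of the full size.\<close>

lemma dict_error_sum:
  assumes fin: "finite D" and sub: "(\<Union>i\<in>I. E i) \<subseteq> D" and "finite I"
    and r: "\<And>i. i \<in> I \<Longrightarrow> r i \<le> card (E i)" and rD: "(\<Sum>i\<in>I. r i) \<le> card D"
  shows "Min ((\<lambda>W. ennreal (ip_norm ip ((\<Sum>i\<in>I. u i) - orth_proj ip W (\<Sum>i\<in>I. u i))))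
           ` dict_spaces (\<Sum>i\<in>I. r i) D)
    \<le> (\<Sum>i\<in>I. Min ((\<lambda>W. ennreal (ip_norm ip (u i - orth_proj ip W (u i)))) ` dict_spaces (r i) (E i)))"
proof -
  let ?f = "\<lambda>v W. ennreal (ip_norm ip (v - orth_proj ip W v))"
  have finE: "finite (E i)" if "i \<in> I" for i
    by (rule finite_subset[OF _ fin]) (use that sub in blast)
  have "\<forall>i\<in>I. \<exists>S. S \<subseteq> E i \<and> card S = r i \<and>
      Min (?f (u i) ` dict_spaces (r i) (E i)) = ?f (u i) (vec.span S)"
  proof
    fix i assume i: "i \<in> I"
    obtain T where "T \<subseteq> E i" "card T = r i"
      using obtain_subset_with_card_n[OF r[OF i]] by metis
    then have "dict_spaces (r i) (E i) \<noteq> {}"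
      unfolding dict_spaces_def by blast
    then have "Min (?f (u i) ` dict_spaces (r i) (E i)) \<in> ?f (u i) ` dict_spaces (r i) (E i)"
      using finE[OF i] by (intro Min_in finite_imageI finite_dict_spaces) auto
    then obtain W where W: "W \<in> dict_spaces (r i) (E i)"
      "Min (?f (u i) ` dict_spaces (r i) (E i)) = ?f (u i) W"
      by (rule imageE)
    from W(1) obtain S where "W = vec.span S" "S \<subseteq> E i" "card S = r i"
      unfolding dict_spaces_def by blast
    with W(2) show "\<exists>S. S \<subseteq> E i \<and> card S = r i \<and>
        Min (?f (u i) ` dict_spaces (r i) (E i)) = ?f (u i) (vec.span S)"
      by blast
  qed
  from bchoice[OF this] obtain S where S: "\<And>i. i \<in> I \<Longrightarrow> S i \<subseteq> E i" "\<And>i. i \<in> I \<Longrightarrow> card (S i) = r i"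
    "\<And>i. i \<in> I \<Longrightarrow> Min (?f (u i) ` dict_spaces (r i) (E i)) = ?f (u i) (vec.span (S i))"
    by blast
  \<comment> \<open>The \<open>S i\<close> may overlap, so their union can be too small; it is
    filled up inside \<open>D\<close> to a set \<open>T\<close> of the exact size.\<close>
  have "card (\<Union>(S ` I)) \<le> (\<Sum>i\<in>I. r i)"
    using card_UN_le[OF \<open>finite I\<close>, of S] S(2) by simp
  moreover have "\<Union>(S ` I) \<subseteq> D" using S(1) sub by blast
  ultimately have "\<exists>T. \<Union>(S ` I) \<subseteq> T \<and> T \<subseteq> D \<and> card T = (\<Sum>i\<in>I. r i)"
    by (rule exists_subset_between[OF _ rD _ fin])
  then obtain T where T: "\<Union>(S ` I) \<subseteq> T" "T \<subseteq> D" "card T = (\<Sum>i\<in>I. r i)"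
    by blast
  have finT: "finite T" using T(2) fin by (rule finite_subset)
  let ?p = "\<lambda>i. orth_proj ip (vec.span (S i)) (u i)"
  have "?p i \<in> vec.span T" if i: "i \<in> I" for i
  proof -
    have "S i \<subseteq> T" using T(1) i by blast
    from vec.span_mono[OF this] orth_proj_span(1)[OF finite_subset[OF this finT], of "u i"]
    show ?thesis by (rule subsetD)
  qed
  \<comment> \<open>The sum of the individual projections is the competitor against which the
    projection onto \<open>vec.span T\<close> is compared.\<close>
  then have "(\<Sum>i\<in>I. ?p i) \<in> vec.span T" by (intro vec.span_sum)
  from orth_proj_best[OF finT this, of "\<Sum>i\<in>I. u i"]
  have "ip_norm ip ((\<Sum>i\<in>I. u i) - orth_proj ip (vec.span T) (\<Sum>i\<in>I. u i))
      \<le> ip_norm ip (\<Sum>i\<in>I. u i - ?p i)"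
    by (simp add: sum_subtractf)
  also have "\<dots> \<le> (\<Sum>i\<in>I. ip_norm ip (u i - ?p i))" by (rule ip_norm_sum_le)
  finally have "?f (\<Sum>i\<in>I. u i) (vec.span T) \<le> (\<Sum>i\<in>I. ?f (u i) (vec.span (S i)))"
    by (simp add: sum_ennreal ennreal_leI)
  moreover have "Min (?f (\<Sum>i\<in>I. u i) ` dict_spaces (\<Sum>i\<in>I. r i) D) \<le> ?f (\<Sum>i\<in>I. u i) (vec.span T)"
  proof (rule Min_le)
    have "vec.span T \<in> dict_spaces (\<Sum>i\<in>I. r i) D"
      using T unfolding dict_spaces_def by blast
    then show "?f (\<Sum>i\<in>I. u i) (vec.span T) \<in> ?f (\<Sum>i\<in>I. u i) ` dict_spaces (\<Sum>i\<in>I. r i) D"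
      by (rule imageI)
  qed (intro finite_imageI finite_dict_spaces fin)
  moreover have "(\<Sum>i\<in>I. Min (?f (u i) ` dict_spaces (r i) (E i)))
      = (\<Sum>i\<in>I. ?f (u i) (vec.span (S i)))"
    by (intro sum.cong refl S(3))
  ultimately show ?thesis by order
qed

lemma dict_width_sum_le:
  fixes u :: "'i \<Rightarrow> 'p \<Rightarrow> 'k ^ 'n"
  assumes "finite I" and rK: "\<And>i. i \<in> I \<Longrightarrow> r i \<le> K i"
  shows "dict_width ip (\<Sum>i\<in>I. r i) ((\<lambda>\<mu>. \<Sum>i\<in>I. u i \<mu>) ` P) (\<Sum>i\<in>I. K i)
     \<le> (\<Sum>i\<in>I. dict_width ip (r i) (u i ` P) (K i))"
proof -
  \<comment> \<open>Naming the supremum turns each width into a plain infimum over dictionaries, the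
    shape needed for \<open>le_sum_INF_ennreal\<close>.\<close>
  define g where "g r M D = (SUP v \<in> M.
      Min ((\<lambda>W. ennreal (ip_norm ip (v - orth_proj ip W v))) ` dict_spaces r D))" for r M D
  have width: "dict_width ip r M K = (INF D \<in> {D. finite D \<and> card D = K}. g r M D)" for r M K
    by (simp add: dict_width_def g_def)
  show ?thesis unfolding width
  proof (rule le_sum_INF_ennreal[OF \<open>finite I\<close>])
    fix E :: "'i \<Rightarrow> ('k ^ 'n) set"
    assume E: "\<And>i. i \<in> I \<Longrightarrow> E i \<in> {D. finite D \<and> card D = K i}"
    have "card (\<Union>i\<in>I. E i) \<le> (\<Sum>i\<in>I. K i)"
      using card_UN_le[OF \<open>finite I\<close>, of E] E by simp
    then obtain D :: "('k ^ 'n) set" where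
      D: "(\<Union>i\<in>I. E i) \<subseteq> D" "finite D" "card D = (\<Sum>i\<in>I. K i)"
      using finite_superset_card[OF infinite_UNIV_vec, of "\<Union>i\<in>I. E i"] E \<open>finite I\<close> by auto
    have "g (\<Sum>i\<in>I. r i) ((\<lambda>\<mu>. \<Sum>i\<in>I. u i \<mu>) ` P) D \<le> (\<Sum>i\<in>I. g (r i) (u i ` P) (E i))"
      unfolding g_def
    proof (rule SUP_least, clarify)
      fix \<mu> assume "\<mu> \<in> P"
      let ?e = "\<lambda>i v. Min ((\<lambda>W. ennreal (ip_norm ip (v - orth_proj ip W v))) ` dict_spaces (r i) (E i))"
      have "Min ((\<lambda>W. ennreal (ip_norm ip ((\<Sum>i\<in>I. u i \<mu>) - orth_proj ip W (\<Sum>i\<in>I. u i \<mu>))))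
             ` dict_spaces (\<Sum>i\<in>I. r i) D) \<le> (\<Sum>i\<in>I. ?e i (u i \<mu>))"
        using D E rK \<open>finite I\<close> by (intro dict_error_sum) (simp_all add: sum_mono)
      \<comment> \<open>Each summand passes to its own supremum, giving a bound independent of the
        common parameter \<mu>.\<close>
      also have "\<dots> \<le> (\<Sum>i\<in>I. SUP v\<in>u i ` P. ?e i v)"
        using \<open>\<mu> \<in> P\<close> by (intro sum_mono SUP_upper imageI)
      finally show "Min ((\<lambda>W. ennreal (ip_norm ip ((\<Sum>i\<in>I. u i \<mu>) - orth_proj ip W (\<Sum>i\<in>I. u i \<mu>))))
             ` dict_spaces (\<Sum>i\<in>I. r i) D) \<le> (\<Sum>i\<in>I. SUP v\<in>u i ` P. ?e i v)" .
    qed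
    with D show "(INF D \<in> {D. finite D \<and> card D = (\<Sum>i\<in>I. K i)}.
        g (\<Sum>i\<in>I. r i) ((\<lambda>\<mu>. \<Sum>i\<in>I. u i \<mu>) ` P) D) \<le> (\<Sum>i\<in>I. g (r i) (u i ` P) (E i))"
      by (intro INF_lower2[of D]) auto
  qed
qed

end

section \<open>Matrix inner products as instances\<close>

text \<open>The work lies in conjugate symmetry: \<open>c\<close> is moved inside the double sum,
  its involutivity and the Hermitian entries are used, and the summations are exchanged.\<close>

lemma conj_inner_mat_inner:
  fixes R :: "'k::real_normed_field ^ 'n ^ 'n"
  assumes add: "\<And>a b. c (a + b) = c a + c b" and mult: "\<And>a b. c (a * b) = c a * c b"
    and norm: "\<And>a. norm (c a) = norm a" and inv: "\<And>a. c (c a) = a"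
    and R: "hermitian_posdef c R"
  shows "conj_inner c (mat_inner c R)"
proof
  have csum: "c (\<Sum>i\<in>A. f i) = (\<Sum>i\<in>A. c (f i))" for A :: "'n set" and f
    \<comment> \<open>Preserving the norm forces \<open>c 0 = 0\<close>, which settles the empty
      sum.\<close>
    using norm[of 0] by (induction A rule: infinite_finite_induct) (simp_all add: add)
  have herm: "c (R $ i $ j) = R $ j $ i" for i j
    using R unfolding hermitian_posdef_def by metis
  fix x y :: "'k ^ 'n"
  have "c (mat_inner c R x y) = (\<Sum>i\<in>UNIV. \<Sum>j\<in>UNIV. R $ j $ i * c (x $ j) * y $ i)"
    by (simp add: mat_inner_def matrix_vector_mult_def csum mult inv herm sum_distrib_right)
  also have "\<dots> = (\<Sum>j\<in>UNIV. \<Sum>i\<in>UNIV. R $ j $ i * c (x $ j) * y $ i)"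
    by (rule sum.swap)
  also have "\<dots> = mat_inner c R y x"
    by (simp add: mat_inner_def matrix_vector_mult_def sum_distrib_left sum_distrib_right mult_ac)
  finally show "mat_inner c R y x = c (mat_inner c R x y)" ..
next
  show "\<exists>t>0. mat_inner c R x x = of_real t" if "x \<noteq> 0" for x
    using R that unfolding hermitian_posdef_def by blast
qed (simp_all add: assms mat_inner_def matrix_vector_right_distrib vector_scalar_commute
      distrib_right sum.distrib sum_distrib_left mult.assoc)

theorem proposition4p1:
  fixes P :: "'p set" and l :: nat and r K :: "nat \<Rightarrow> nat"
  assumes "P \<noteq> {}" and "l \<ge> 1"
    and "\<And>i. i \<in> {1..l} \<Longrightarrow> 1 \<le> r i \<and> r i \<le> K i"
  shows
    "(\<forall>(R :: real ^ 'n ^ 'n) (u :: nat \<Rightarrow> 'p \<Rightarrow> real ^ 'n). hermitian_posdef id R \<longrightarrow>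
        dict_width (mat_inner id R) (\<Sum>i=1..l. r i) ((\<lambda>\<mu>. \<Sum>i=1..l. u i \<mu>) ` P) (\<Sum>i=1..l. K i)
          \<le> (\<Sum>i=1..l. dict_width (mat_inner id R) (r i) (u i ` P) (K i))) \<and>
     (\<forall>(R :: complex ^ 'n ^ 'n) (u :: nat \<Rightarrow> 'p \<Rightarrow> complex ^ 'n). hermitian_posdef cnj R \<longrightarrow>
        dict_width (mat_inner cnj R) (\<Sum>i=1..l. r i) ((\<lambda>\<mu>. \<Sum>i=1..l. u i \<mu>) ` P) (\<Sum>i=1..l. K i)
          \<le> (\<Sum>i=1..l. dict_width (mat_inner cnj R) (r i) (u i ` P) (K i)))"
proof (intro conjI allI impI)
  have rK: "r i \<le> K i" if "i \<in> {1..l}" for i using assms(3) that by blast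
  fix R :: "real ^ 'n ^ 'n" and u :: "nat \<Rightarrow> 'p \<Rightarrow> real ^ 'n"
  assume "hermitian_posdef id R"
  then interpret conj_inner id "mat_inner id R" by (intro conj_inner_mat_inner) auto
  show "dict_width (mat_inner id R) (\<Sum>i=1..l. r i) ((\<lambda>\<mu>. \<Sum>i=1..l. u i \<mu>) ` P) (\<Sum>i=1..l. K i)
      \<le> (\<Sum>i=1..l. dict_width (mat_inner id R) (r i) (u i ` P) (K i))"
    by (intro dict_width_sum_le rK) auto
next
  have rK: "r i \<le> K i" if "i \<in> {1..l}" for i using assms(3) that by blast
  fix R :: "complex ^ 'n ^ 'n" and u :: "nat \<Rightarrow> 'p \<Rightarrow> complex ^ 'n"
  assume "hermitian_posdef cnj R"
  then interpret conj_inner cnj "mat_inner cnj R" by (intro conj_inner_mat_inner) auto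
  show "dict_width (mat_inner cnj R) (\<Sum>i=1..l. r i) ((\<lambda>\<mu>. \<Sum>i=1..l. u i \<mu>) ` P) (\<Sum>i=1..l. K i)
      \<le> (\<Sum>i=1..l. dict_width (mat_inner cnj R) (r i) (u i ` P) (K i))"
    by (intro dict_width_sum_le rK) auto
qed

end
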